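(* Let $P(\lambda)=\sum_{i=0}^k\lambda^iA_i$ be a regular $n\times n$ matrix polynomial with $A_i\in\mathbb{C}^{n\times n}$, let $r$ be a positive integer, and let $\gamma=[\gamma_1\ \cdots\ \gamma_r]$ with $\gamma_i>0$ for $i=1,\dots,r$. A scalar $\lambda_0\in\mathbb{C}$ is an eigenvalue of $P(\lambda)$ of algebraic multiplicity at least $r+1$ if and only if the rank of $T_\gamma(P,\lambda_0)$ is at most $(r+1)(n-1)$.
   Context: A matrix polynomial $P(\lambda)$ is regular if $\det P(\lambda)\not\equiv0$. In that case the eigenvalues of $P(\lambda)$ are the roots of $\det P(\lambda)$, and the algebraic multiplicity of an eigenvalue is its multiplicity as a root. For an $n\times n$ matrix polynomial $Q(\lambda)$ and $\alpha\in\mathbb{C}$, let $Q^{i}(\alpha)$ denote the $i$-th derivative of $Q$ at $\alpha$ (with $Q^0=Q$). Then $T_\gamma(Q,\alpha)$ is the $(r+1)n\times(r+1)n$ block lower triangular matrix whose $n\times n$ block in block position $(i,j)$, $1\leqslant i,j\leqslant r+1$, is $$\left(\prod_{l=j}^{i-1}\gamma_l\right)\frac{Q^{i-j}(\alpha)}{(i-j)!}\ \text{ if } i\geqslant j,\qquad 0\ \text{ if } i<j,$$ an empty product being $1$. That is, $$T_\gamma(Q,\alpha)=\begin{bmatrix}Q(\alpha)&&&\\ \gamma_1Q'(\alpha)&Q(\alpha)&&\\ \vdots&\ddots&\ddots&\\ \prod_{i=1}^r\gamma_i\frac{Q^r(\alpha)}{r!}&\cdots&\gamma_rQ'(\alpha)&Q(\alpha)\end{bmatrix}.$$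 *)

theory Defs
  imports Complex_Main "Jordan_Normal_Form.DL_Rank"
    "HOL-Computational_Algebra.Polynomial"
begin

text \<open>A matrix polynomial is a matrix with entries in the polynomial ring.\<close>

definition matrix_poly :: "nat \<Rightarrow> nat \<Rightarrow> (nat \<Rightarrow> complex mat) \<Rightarrow> complex poly mat" where
  "matrix_poly n k A = mat n n (\<lambda>(a, b). \<Sum>i\<le>k. monom (A i $$ (a, b)) i)"

definition mp_eval :: "complex poly mat \<Rightarrow> complex \<Rightarrow> complex mat" where
  "mp_eval Q \<alpha> = map_mat (\<lambda>p. poly p \<alpha>) Q"

lemma mp_eval_matrix_poly:
  "mp_eval (matrix_poly n k A) \<alpha> = mat n n (\<lambda>(a, b). \<Sum>i\<le>k. \<alpha> ^ i * A i $$ (a, b))"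
  by (rule eq_matI) (auto simp: mp_eval_def matrix_poly_def poly_sum poly_monom mult.commute)

definition mp_deriv :: "nat \<Rightarrow> complex poly mat \<Rightarrow> complex poly mat" where
  "mp_deriv m Q = map_mat (pderiv ^^ m) Q"

text \<open>The determinant is taken over the ring of polynomials, so that
  \<^term>\<open>det Q \<noteq> 0\<close> says that it is not the zero polynomial.\<close>

definition mp_regular :: "complex poly mat \<Rightarrow> bool" where
  "mp_regular Q \<longleftrightarrow> det Q \<noteq> 0"

text \<open>The next two notions are meaningful for regular \<^term>\<open>Q\<close> only.\<close>

definition mp_eigenvalue :: "complex poly mat \<Rightarrow> complex \<Rightarrow> bool" where
  "mp_eigenvalue Q \<alpha> \<longleftrightarrow> poly (det Q) \<alpha> = 0"

definition mp_alg_mult :: "complex poly mat \<Rightarrow> complex \<Rightarrow> nat" where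
  "mp_alg_mult Q \<alpha> = order \<alpha> (det Q)"

text \<open>Block positions \<^term>\<open>i\<close>, \<^term>\<open>j\<close> are counted from 1, as are
  the weights \<open>\<gamma> 1, \<dots>, \<gamma> r\<close>. Matrix entries are counted from 0, so the entry
  \<open>(a, b)\<close> of \<open>T_gamma\<close> lies in block \<open>(a div n + 1, b div n + 1)\<close>, at position
  \<open>(a mod n, b mod n)\<close> there.\<close>

definition T_block :: "nat \<Rightarrow> (nat \<Rightarrow> real) \<Rightarrow> complex poly mat \<Rightarrow> complex \<Rightarrow> nat \<Rightarrow> nat \<Rightarrow> complex mat"
  where
  "T_block n \<gamma> Q \<alpha> i j =
     (if j \<le> i
      then (complex_of_real (\<Prod>l\<in>{j..<i}. \<gamma> l) / fact (i - j)) \<cdot>\<^sub>m mp_eval (mp_deriv (i - j) Q) \<alpha>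
      else 0\<^sub>m n n)"

definition T_gamma :: "nat \<Rightarrow> nat \<Rightarrow> (nat \<Rightarrow> real) \<Rightarrow> complex poly mat \<Rightarrow> complex \<Rightarrow> complex mat" where
  "T_gamma n r \<gamma> Q \<alpha> =
     mat ((r + 1) * n) ((r + 1) * n)
       (\<lambda>(a, b). T_block n \<gamma> Q \<alpha> (a div n + 1) (b div n + 1) $$ (a mod n, b mod n))"

end

theory Submission
  imports Defs "Jordan_Normal_Form.Matrix_Kernel"
begin

text \<open>
  Let \<open>N = r + 1\<close>. Multiplication by \<open>P\<close> on vectors of polynomials modulo \<open>(x - \<alpha>) ^ N\<close> has the
  matrix \<open>T_gamma\<close>, up to a rescaling of the basis that absorbs the weights. Therefore
  \<open>P \<mapsto> T P\<close> is multiplicative (\<open>T_mult\<close>). The rank bound \<open>N * (n - 1)\<close> says that the nullity of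
  \<open>T P\<close> is at least \<open>N\<close>, so the claim is that this nullity reaches \<open>N\<close> exactly when the order \<open>m\<close> of
  \<open>det P\<close> at \<open>\<alpha>\<close> does.

  The local Smith form would give the nullity as the sum of the \<open>min d\<^sub>i N\<close> over the partial
  multiplicities \<open>d\<^sub>i\<close>, whose sum is \<open>m\<close>. The proof below needs less. If \<open>P(\<alpha>)\<close> is singular, a
  right factor with determinant \<open>x - \<alpha>\<close> can be split off (\<open>split_linear_factor\<close>), and the Toeplitz
  matrix of this factor has nullity at most one. Nullity is subadditive on products, so the nullity of
  \<open>T P\<close> is at most \<open>m\<close> (\<open>kernel_dim_T_le_order\<close>).

  For the converse, let \<open>m \<ge> N\<close>. Splitting off \<open>N\<close> such factors gives \<open>P = R * L\<close> where \<open>det L\<close> is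
  \<open>(x - \<alpha>) ^ N\<close>, and the kernel of \<open>T L\<close> lies in that of \<open>T P\<close>. Since
  \<open>L * adj_mat L = det L \<cdot>\<^sub>m 1\<^sub>m n\<close> vanishes modulo \<open>(x - \<alpha>) ^ N\<close>, subadditivity shows that the
  nullities of \<open>T L\<close> and \<open>T (adj_mat L)\<close> have sum at least \<open>N * n\<close>. The upper bound already proved,
  applied to the adjugate, whose determinant is \<open>(x - \<alpha>) ^ (N * (n - 1))\<close>, leaves nullity at least
  \<open>N\<close> for \<open>T L\<close> (\<open>kernel_dim_T_ge\<close>).
\<close>

section \<open>Nullity of matrix products\<close>

text \<open>Rank-nullity for multiplication by \<open>B\<close>, restricted to the kernel of \<open>A * B\<close>, which contains
  the kernel of \<open>B\<close>. Its image lies in the kernel of \<open>A\<close>. Monotonicity and subadditivity of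
  the nullity on products follow at once, and a zero matrix \<open>A\<close> gives rank-nullity for \<open>B\<close> itself.
  That the image \<open>W\<close> is a finite-dimensional subspace makes its dimension comparable with
  that of the kernel of \<open>A\<close>.\<close>
lemma kernel_dim_mult:
  fixes A B :: "'a :: field mat"
  assumes A: "A \<in> carrier_mat nr m" and B: "B \<in> carrier_mat m nc"
  defines "W \<equiv> (\<lambda>v. B *\<^sub>v v) ` mat_kernel (A * B)"
  shows "vectorspace.dim class_ring ((module_vec TYPE('a) m)\<lparr>carrier := W\<rparr>) + kernel_dim B
           = kernel_dim (A * B)" (is ?dim)
    and "subspace class_ring W (module_vec TYPE('a) m)" (is ?sub)
    and "vectorspace.fin_dim class_ring ((module_vec TYPE('a) m)\<lparr>carrier := W\<rparr>)" (is ?fin)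
proof -
  have AB: "A * B \<in> carrier_mat nr nc" using A B by simp
  interpret KAB: kernel nr nc "A * B" by unfold_locales (rule AB)
  interpret KB: kernel m nc B by unfold_locales (rule B)
  interpret M: vec_space "TYPE('a)" m .
  note ker = mat_kernel[OF AB]
  show sub: ?sub
  proof (unfold subspace_def, intro conjI)
    show "vectorspace class_ring (module_vec TYPE('a) m)" by (rule vec_vs)
    show "submodule class_ring W (module_vec TYPE('a) m)"
    proof (unfold_locales, goal_cases)
      case 1
      show ?case using B by (auto simp: W_def ker)
    next
      case (2 v w)
      then obtain v' w' where v': "v' \<in> mat_kernel (A * B)" "v = B *\<^sub>v v'"
        and w': "w' \<in> mat_kernel (A * B)" "w = B *\<^sub>v w'"
        by (auto simp: W_def)
      have "v' + w' \<in> mat_kernel (A * B)"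
        using KAB.Ker.a_closed v' w' by blast
      moreover have "B *\<^sub>v (v' + w') = v + w"
        using B v' w' mult_add_distrib_mat_vec[OF B] by (auto simp: ker)
      ultimately have "v + w \<in> W" unfolding W_def by (metis imageI)
      thus ?case by (simp add: module_vec_simps)
    next
      case 3
      have "0\<^sub>v nc \<in> mat_kernel (A * B)" using KAB.Ker.zero_closed by blast
      moreover have "B *\<^sub>v 0\<^sub>v nc = 0\<^sub>v m" using B by auto
      ultimately have "0\<^sub>v m \<in> W" unfolding W_def by (metis imageI)
      thus ?case by (simp add: module_vec_simps)
    next
      case (4 c v)
      then obtain v' where v': "v' \<in> mat_kernel (A * B)" "v = B *\<^sub>v v'" by (auto simp: W_def)
      have "c \<cdot>\<^sub>v v' \<in> mat_kernel (A * B)" by (rule mat_kernel_smult[OF AB v'(1)])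
      moreover have "B *\<^sub>v (c \<cdot>\<^sub>v v') = c \<cdot>\<^sub>v v"
        using v' mult_mat_vec[OF B] by (auto simp: ker)
      ultimately have "c \<cdot>\<^sub>v v \<in> W" unfolding W_def by (metis imageI)
      thus ?case by (simp add: module_vec_simps)
    qed
  qed
  interpret lm: linear_map class_ring KAB.VK "(module_vec TYPE('a) m)\<lparr>carrier := W\<rparr>" "\<lambda>v. B *\<^sub>v v"
  proof (intro linear_map.intro)
    show "vectorspace class_ring KAB.VK" by unfold_locales
    show vs: "vectorspace class_ring ((module_vec TYPE('a) m)\<lparr>carrier := W\<rparr>)"
      by (rule M.subspace_is_vs[OF sub])
    show "mod_hom class_ring KAB.VK ((module_vec TYPE('a) m)\<lparr>carrier := W\<rparr>) (\<lambda>v. B *\<^sub>v v)"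
    proof (intro mod_hom.intro mod_hom_axioms.intro)
      show "module class_ring KAB.VK" by unfold_locales
      show "module class_ring ((module_vec TYPE('a) m)\<lparr>carrier := W\<rparr>)"
        using vs by (simp add: vectorspace_def)
      show "(\<lambda>v. B *\<^sub>v v) \<in> LinearCombinations.module_hom class_ring KAB.VK ((module_vec TYPE('a) m)\<lparr>carrier := W\<rparr>)"
        using mult_add_distrib_mat_vec[OF B] mult_mat_vec[OF B]
        by (auto simp: LinearCombinations.module_hom_def W_def ker module_vec_simps)
    qed
  qed
  from kernel_basis_exists[OF AB]
  have fin: "KAB.Ker.fin_dim"
    unfolding KAB.Ker.fin_dim_def KAB.Ker.basis_def by blast
  have "lm.im = W" by (simp add: lm.im_def W_def)
  moreover have "lm.ker = mat_kernel B"
    using A B unfolding lm.ker_def by (auto simp: ker mat_kernel[OF B] module_vec_simps)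
  ultimately show ?dim
    using lm.rank_nullity[OF fin] by simp
  show ?fin
    by (rule lm.rank_nullity_main(2)[OF fin]) (simp add: W_def)
qed

lemma kernel_dim_right_le:
  fixes A B :: "'a :: field mat"
  assumes "A \<in> carrier_mat nr m" "B \<in> carrier_mat m nc"
  shows "kernel_dim B \<le> kernel_dim (A * B)"
  using kernel_dim_mult(1)[OF assms] by simp

lemma kernel_dim_mult_le:
  fixes A B :: "'a :: field mat"
  assumes A: "A \<in> carrier_mat nr m" and B: "B \<in> carrier_mat m nc"
  shows "kernel_dim (A * B) \<le> kernel_dim A + kernel_dim B"
proof -
  interpret KA: kernel nr m A by unfold_locales (rule A)
  let ?W = "(\<lambda>v. B *\<^sub>v v) ` mat_kernel (A * B)"
  have sub: "?W \<subseteq> mat_kernel A"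
    using A B by (auto simp: mat_kernel_def)
  have ks: "subspace class_ring (mat_kernel A) (module_vec TYPE('a) m)"
    unfolding subspace_def
  proof (intro conjI vec_vs)
    show "submodule class_ring (mat_kernel A) (module_vec TYPE('a) m)"
      using A mult_add_distrib_mat_vec[OF A] mult_mat_vec[OF A] mat_kernel[OF A]
      by (unfold_locales) (auto simp: module_vec_simps)
  qed
  from kernel_basis_exists[OF A]
  have fin: "KA.Ker.fin_dim"
    unfolding KA.Ker.fin_dim_def KA.Ker.basis_def by blast
  have "subspace class_ring ?W KA.VK"
    by (rule KA.NC.nested_subspaces[OF ks kernel_dim_mult(2)[OF A B] sub])
  from KA.Ker.subspace_dim[OF this fin] kernel_dim_mult(3)[OF A B]
  have "vectorspace.dim class_ring ((module_vec TYPE('a) m)\<lparr>carrier := ?W\<rparr>) \<le> kernel_dim A"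
    by simp
  with kernel_dim_mult(1)[OF A B] show ?thesis by simp
qed

lemma kernel_dim_zero_mat [simp]: "kernel_dim (0\<^sub>m nr nc :: 'a :: field mat) = nc"
proof -
  interpret K: kernel nr nc "0\<^sub>m nr nc :: 'a mat" by unfold_locales simp
  have "mat_kernel (0\<^sub>m nr nc :: 'a mat) = carrier_vec nc" by (auto simp: mat_kernel_def)
  hence "K.VK = module_vec TYPE('a) nc" by (simp add: module_vec_def)
  thus ?thesis using K.NC.dim_is_n by simp
qed

lemma rank_plus_kernel_dim:
  fixes A :: "'a :: field mat"
  assumes A: "A \<in> carrier_mat m nc"
  shows "vec_space.rank m A + kernel_dim A = nc"
proof -
  interpret M: vec_space "TYPE('a)" m .
  \<comment> \<open>The matrix without rows has full kernel, so \<open>W\<close> becomes the whole column space.\<close>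
  let ?Z = "0\<^sub>m 0 m :: 'a mat"
  have ZA: "?Z * A = 0\<^sub>m 0 nc" using A by auto
  have "(\<lambda>v. A *\<^sub>v v) ` mat_kernel (?Z * A) = M.col_space A"
    unfolding M.col_space_eq[OF A] ZA using A by (force simp: mat_kernel_def)
  with kernel_dim_mult(1)[of ?Z 0 m A nc] A show ?thesis
    by (simp add: ZA M.rank_def M.col_space_def)
qed

lemma kernel_dim_eq_0:
  fixes A :: "'a :: field mat"
  assumes A: "A \<in> carrier_mat m m" and "det A \<noteq> 0"
  shows "kernel_dim A = 0"
  using rank_plus_kernel_dim[OF A] vec_space.low_rank_det_zero[OF assms] by simp

lemma kernel_dim_le_1:
  fixes A :: "'a :: field mat"
  assumes A: "A \<in> carrier_mat nr nc" and v: "v \<in> mat_kernel A"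
    and multiple: "\<And>w. w \<in> mat_kernel A \<Longrightarrow> \<exists>c. w = c \<cdot>\<^sub>v v"
  shows "kernel_dim A \<le> 1"
proof -
  interpret K: kernel nr nc A by unfold_locales (rule A)
  have "K.dim \<le> 1"
  proof (rule K.Ker.dim_le1I[OF _ v])
    have "{v} \<subseteq> carrier_vec nc" using mat_kernel_carrier[OF A] v by blast
    hence "c \<cdot>\<^sub>v v \<in> K.span {v}" for c
      using v by (subst K.span_same) (auto intro: K.NC.smult_in_span K.NC.span_mem)
    hence "mat_kernel A \<subseteq> K.span {v}" using multiple by blast
    moreover have "K.span {v} \<subseteq> mat_kernel A"
      using v by (intro K.Ker.span_is_subset2) auto
    ultimately show "K.span {v} = mat_kernel A" by blast
  qed
  thus ?thesis by simp
qed

section \<open>Taylor coefficients and block indices\<close>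

text \<open>The entries of the blocks are Taylor coefficients at \<open>\<alpha>\<close>. Expressed as coefficients of a
  shifted polynomial they behave well under products, since \<open>p \<mapsto> p \<circ>\<^sub>p [:\<alpha>, 1:]\<close> is a ring
  homomorphism.\<close>
lemma coeff_pcompose_shift:
  fixes p :: "'a :: field_char_0 poly"
  shows "coeff (p \<circ>\<^sub>p [:\<alpha>, 1:]) m = poly ((pderiv ^^ m) p) \<alpha> / fact m"
proof -
  have shift: "(pderiv ^^ m) p \<circ>\<^sub>p [:\<alpha>, 1:] = (pderiv ^^ m) (p \<circ>\<^sub>p [:\<alpha>, 1:])"
  proof (induction m)
    case (Suc m)
    have "pderiv ((pderiv ^^ m) p) \<circ>\<^sub>p [:\<alpha>, 1:] = pderiv ((pderiv ^^ m) p \<circ>\<^sub>p [:\<alpha>, 1:])"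
      by (simp add: pderiv_pcompose pderiv_pCons)
    thus ?case by (simp add: Suc.IH)
  qed simp
  have "poly ((pderiv ^^ m) p) \<alpha> = poly ((pderiv ^^ m) p \<circ>\<^sub>p [:\<alpha>, 1:]) 0"
    by (simp add: poly_pcompose)
  also have "\<dots> = coeff ((pderiv ^^ m) (p \<circ>\<^sub>p [:\<alpha>, 1:])) 0"
    by (simp add: shift poly_0_coeff_0)
  also have "\<dots> = fact m * coeff (p \<circ>\<^sub>p [:\<alpha>, 1:]) m"
    by (simp add: coeff_higher_pderiv pochhammer_fact)
  finally show ?thesis by simp
qed

lemma sum_div_mod:
  fixes f :: "nat \<Rightarrow> nat \<Rightarrow> 'a :: comm_monoid_add"
  assumes "n > 0"
  shows "(\<Sum>c<N * n. f (c div n) (c mod n)) = (\<Sum>j<N. \<Sum>d<n. f j d)"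
proof -
  have "(\<Sum>c<N * n. f (c div n) (c mod n)) = (\<Sum>(j, d)\<in>{..<N} \<times> {..<n}. f j d)"
  proof (rule sum.reindex_bij_witness[of _ "\<lambda>(j, d). j * n + d" "\<lambda>c. (c div n, c mod n)"], goal_cases)
    case (2 c)
    thus ?case using assms by (auto simp: less_mult_imp_div_less)
  next
    case (4 b)
    obtain j d where b: "b = (j, d)" "j < N" "d < n" using 4 by auto
    have "j * n + d < Suc j * n" using b by simp
    also have "\<dots> \<le> N * n" using b by (intro mult_le_mono1) simp
    finally show ?case using b by simp
  qed (use assms in auto)
  thus ?thesis by (simp add: sum.cartesian_product)
qed

lemma coeff_shift_mult_power:
  fixes q :: "'a :: comm_ring_1 poly"
  shows "coeff (([:-\<alpha>, 1:] ^ N * q) \<circ>\<^sub>p [:\<alpha>, 1:]) m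
    = (if m < N then 0 else coeff (q \<circ>\<^sub>p [:\<alpha>, 1:]) (m - N))"
proof -
  have "([:-\<alpha>, 1:] ^ N * q) \<circ>\<^sub>p [:\<alpha>, 1:] = monom 1 N * (q \<circ>\<^sub>p [:\<alpha>, 1:])"
  proof (induction N)
    case (Suc N)
    have "([:-\<alpha>, 1:] ^ Suc N * q) \<circ>\<^sub>p [:\<alpha>, 1:] = ([:-\<alpha>, 1:] \<circ>\<^sub>p [:\<alpha>, 1:]) * (([:-\<alpha>, 1:] ^ N * q) \<circ>\<^sub>p [:\<alpha>, 1:])"
      by (simp only: power_Suc mult.assoc pcompose_mult)
    also have "[:-\<alpha>, 1:] \<circ>\<^sub>p [:\<alpha>, 1:] = monom 1 1"
      by (simp add: pcompose_pCons monom_altdef)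
    finally show ?case using Suc.IH
      by (simp add: mult_monom flip: mult.assoc)
  qed simp
  thus ?thesis by (simp add: coeff_monom_mult)
qed

lemma det_mp_eval: "P \<in> carrier_mat n n \<Longrightarrow> det (mp_eval P \<beta>) = poly (det P) \<beta>"
proof -
  interpret hom: comm_ring_hom "\<lambda>p. poly p \<beta>" by unfold_locales auto
  show ?thesis unfolding mp_eval_def by (rule hom.hom_det)
qed

section \<open>Block Toeplitz matrices\<close>

locale block_toeplitz =
  fixes n r :: nat and \<gamma> :: "nat \<Rightarrow> real" and \<alpha> :: complex
  assumes n_pos: "n > 0"
    and gamma_nonzero: "\<And>i. 1 \<le> i \<Longrightarrow> i \<le> r \<Longrightarrow> \<gamma> i \<noteq> 0"
begin

abbreviation T :: "complex poly mat \<Rightarrow> complex mat" where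
  "T \<equiv> \<lambda>Q. T_gamma n r \<gamma> Q \<alpha>"

abbreviation M :: nat where "M \<equiv> (r + 1) * n"

abbreviation shift :: "complex poly \<Rightarrow> complex poly" where
  "shift p \<equiv> p \<circ>\<^sub>p [:\<alpha>, 1:]"

text \<open>Blocks are counted from 0 here, so \<open>weight j i\<close> belongs to block \<open>(i, j)\<close> and is the product of
  \<open>\<gamma> (j + 1), \<dots>, \<gamma> i\<close>.\<close>
definition weight :: "nat \<Rightarrow> nat \<Rightarrow> complex" where
  "weight j i = complex_of_real (\<Prod>l\<in>{j + 1..<i + 1}. \<gamma> l)"

text \<open>This is why the weights do no harm: they are a multiplicative cocycle, so that weighting
  the blocks amounts to conjugation by a diagonal matrix when all \<open>\<gamma> i\<close> are nonzero.\<close>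
lemma weight_trans: "j \<le> k \<Longrightarrow> k \<le> i \<Longrightarrow> weight j k * weight k i = weight j i"
  by (simp add: weight_def prod.atLeastLessThan_concat flip: of_real_mult del: prod.op_ivl_Suc)

lemma weight_refl [simp]: "weight i i = 1"
  by (simp add: weight_def)

lemma weight_neq_0: "i \<le> r \<Longrightarrow> weight j i \<noteq> 0"
  using gamma_nonzero by (auto simp: weight_def simp del: prod.op_ivl_Suc)

lemma T_carrier [simp]: "T Q \<in> carrier_mat M M"
  by (simp add: T_gamma_def)

lemma block_bounds: "a < M \<Longrightarrow> a div n \<le> r" "a < M \<Longrightarrow> a mod n < n"
  using n_pos by (auto simp: less_Suc_eq_le[symmetric] less_mult_imp_div_less)

lemma T_index:
  assumes Q: "Q \<in> carrier_mat n n" and a: "a < M" and b: "b < M"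
  shows "T Q $$ (a, b) = (if b div n \<le> a div n
    then weight (b div n) (a div n) * coeff (shift (Q $$ (a mod n, b mod n))) (a div n - b div n) else 0)"
proof -
  have "a mod n < n" "b mod n < n" using n_pos by auto
  with Q a b show ?thesis
    by (auto simp: T_gamma_def T_block_def mp_eval_def mp_deriv_def coeff_pcompose_shift weight_def)
qed

text \<open>\<open>T Q\<close> describes multiplication by \<open>Q\<close> on vectors of polynomials modulo
  \<open>(x - \<alpha>) ^ (r + 1)\<close>, in a rescaled basis of powers of \<open>x - \<alpha>\<close>; hence products go to products.
  In terms of entries, the convolution of Taylor coefficients is the product of
  polynomials.\<close>
lemma T_mult:
  assumes R: "R \<in> carrier_mat n n" and L: "L \<in> carrier_mat n n"
  shows "T (R * L) = T R * T L"
proof (rule eq_matI)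
  fix a b assume "a < dim_row (T R * T L)" "b < dim_col (T R * T L)"
  hence ab: "a < M" "b < M" by (simp_all add: T_gamma_def)
  define i a' l b' where "i = a div n" "a' = a mod n" "l = b div n" "b' = b mod n"
  note defs = this
  have bd: "i \<le> r" "a' < n" "l \<le> r" "b' < n" using block_bounds ab unfolding defs by auto
  have RL: "R * L \<in> carrier_mat n n" using R L by simp
  let ?f = "\<lambda>j d. (if j \<le> i then weight j i * coeff (shift (R $$ (a', d))) (i - j) else 0)
    * (if l \<le> j then weight l j * coeff (shift (L $$ (d, b'))) (j - l) else 0)"
  have "(T R * T L) $$ (a, b) = (\<Sum>c<M. T R $$ (a, c) * T L $$ (c, b))"
    using ab by (simp add: scalar_prod_def T_gamma_def lessThan_atLeast0)
  also have "\<dots> = (\<Sum>c<M. ?f (c div n) (c mod n))"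
    using ab by (intro sum.cong refl) (simp add: T_index[OF R] T_index[OF L] defs)
  also have "\<dots> = (\<Sum>j<r + 1. \<Sum>d<n. ?f j d)"
    by (rule sum_div_mod[OF n_pos])
  also have "\<dots> = (\<Sum>d<n. \<Sum>j<r + 1. ?f j d)"
    by (rule sum.swap)
  also have "\<dots> = (if l \<le> i then weight l i * coeff (shift ((R * L) $$ (a', b'))) (i - l) else 0)"
  proof (cases "l \<le> i")
    case True
    have "(\<Sum>j<r + 1. ?f j d) = weight l i * coeff (shift (R $$ (a', d) * L $$ (d, b'))) (i - l)" for d
    proof -
      have "(\<Sum>j<r + 1. ?f j d) = (\<Sum>j\<in>{l..i}. ?f j d)"
        using bd by (intro sum.mono_neutral_right) auto
      also have "\<dots> = (\<Sum>j\<in>{l..i}. weight l i *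
          (coeff (shift (R $$ (a', d))) (i - j) * coeff (shift (L $$ (d, b'))) (j - l)))"
      proof (intro sum.cong refl)
        fix j assume "j \<in> {l..i}"
        thus "?f j d = weight l i *
            (coeff (shift (R $$ (a', d))) (i - j) * coeff (shift (L $$ (d, b'))) (j - l))"
          using weight_trans[of l j i, symmetric] by simp
      qed
      also have "\<dots> = weight l i * (\<Sum>m\<le>i - l. coeff (shift (L $$ (d, b'))) m
          * coeff (shift (R $$ (a', d))) (i - l - m))"
        unfolding sum_distrib_left
        by (rule sum.reindex_bij_witness[of _ "\<lambda>m. l + m" "\<lambda>j. j - l"])
          (use True in \<open>auto simp: mult_ac\<close>)
      finally show ?thesis by (simp add: pcompose_mult coeff_mult mult.commute[of "shift (R $$ (a', d))"])
    qed
    hence "(\<Sum>d<n. \<Sum>j<r + 1. ?f j d)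
        = (\<Sum>d<n. weight l i * coeff (shift (R $$ (a', d) * L $$ (d, b'))) (i - l))" by simp
    also have "\<dots> = weight l i * coeff (shift (\<Sum>d<n. R $$ (a', d) * L $$ (d, b'))) (i - l)"
      by (simp add: pcompose_sum coeff_sum sum_distrib_left)
    also have "(\<Sum>d<n. R $$ (a', d) * L $$ (d, b')) = (R * L) $$ (a', b')"
      using R L bd by (simp add: scalar_prod_def lessThan_atLeast0)
    finally show ?thesis using True by simp
  next
    case False
    thus ?thesis by (auto intro!: sum.neutral)
  qed
  also have "\<dots> = T (R * L) $$ (a, b)"
    using T_index[OF RL ab] by (simp add: defs)
  finally show "T (R * L) $$ (a, b) = (T R * T L) $$ (a, b)" by simp
qed (simp_all add: T_gamma_def)

text \<open>After multiplication by the adjugate only a scalar polynomial that does not vanish at \<open>\<alpha>\<close>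
  is left, and its Toeplitz matrix is lower triangular with the value at \<open>\<alpha>\<close> on the
  diagonal.\<close>
lemma kernel_dim_T_nonsingular:
  assumes P: "P \<in> carrier_mat n n" and nz: "poly (det P) \<alpha> \<noteq> 0"
  shows "kernel_dim (T P) = 0"
proof -
  let ?D = "det P \<cdot>\<^sub>m 1\<^sub>m n"
  have D: "?D \<in> carrier_mat n n" by simp
  have triangular: "T ?D $$ (a, b) = 0" if "a < b" "b < M" for a b
  proof -
    have "a div n \<le> b div n" using that by (simp add: div_le_mono)
    moreover have "a mod n \<noteq> b mod n" if "a div n = b div n"
      using that \<open>a < b\<close> by (metis div_mult_mod_eq less_irrefl)
    ultimately show ?thesis
      using that n_pos T_index[OF D, of a b] by auto
  qed
  have "diag_mat (T ?D) = map (\<lambda>a. poly (det P) \<alpha>) [0..<M]"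
  proof -
    have "T ?D $$ (a, a) = poly (det P) \<alpha>" if "a < M" for a
      using that n_pos T_index[OF D that that] by (simp add: coeff_pcompose_shift)
    thus ?thesis by (simp add: diag_mat_def T_gamma_def)
  qed
  hence "det (T ?D) \<noteq> 0"
    using nz by (subst det_lower_triangular[OF triangular T_carrier]) (auto simp: prod_list_zero_iff)
  moreover have "T (adj_mat P) * T P = T ?D"
    using P adj_mat[OF P] by (simp flip: T_mult)
  ultimately have "kernel_dim (T (adj_mat P) * T P) = 0"
    by (simp add: kernel_dim_eq_0[OF T_carrier])
  thus ?thesis using kernel_dim_right_le[OF T_carrier[of "adj_mat P"] T_carrier[of P]] by simp
qed

section \<open>Splitting off linear factors\<close>

text \<open>For \<open>k < n\<close> the simplest matrix polynomial with determinant \<open>x - \<alpha>\<close>.\<close>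
definition linear_diag :: "nat \<Rightarrow> complex poly mat" where
  "linear_diag k = mat_diag n (\<lambda>i. if i = k then [:-\<alpha>, 1:] else 1)"

lemma linear_diag_carrier [simp]: "linear_diag k \<in> carrier_mat n n"
  by (simp add: linear_diag_def mat_diag_def)

lemma linear_diag_index:
  "i < n \<Longrightarrow> j < n \<Longrightarrow> linear_diag k $$ (i, j) = (if i = j then if j = k then [:-\<alpha>, 1:] else 1 else 0)"
  by (simp add: linear_diag_def mat_diag_def)

lemma det_linear_diag: "k < n \<Longrightarrow> det (linear_diag k) = [:-\<alpha>, 1:]"
proof -
  assume k: "k < n"
  have "det (linear_diag k) = prod_list (diag_mat (linear_diag k))"
    by (rule det_upper_triangular[OF _ linear_diag_carrier]) (auto simp: linear_diag_def mat_diag_def)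
  also have "\<dots> = (\<Prod>i\<in>{0..<n}. linear_diag k $$ (i, i))"
    unfolding prod.list_conv_set_nth by (rule prod.cong) (use carrier_matD[OF linear_diag_carrier] in \<open>auto simp: diag_mat_def\<close>)
  also have "\<dots> = (\<Prod>i\<in>{0..<n}. if i = k then [:-\<alpha>, 1:] else 1)"
    by (rule prod.cong) (auto simp: linear_diag_index)
  finally show ?thesis using k by (simp add: prod.delta)
qed

text \<open>Coordinate \<open>k\<close> of each block is moved down to the next block, where it gets a weight; all other
  coordinates stay in place.\<close>
lemma T_linear_diag_index:
  assumes a: "a < M" and b: "b < M"
  shows "T (linear_diag k) $$ (a, b) = (if a mod n = k
     then if a = b + n then weight (b div n) (a div n) else 0 else if a = b then 1 else 0)"
proof -
  have mod: "a mod n < n" "b mod n < n" using n_pos by auto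
  have eq: "a = b \<longleftrightarrow> a mod n = b mod n \<and> a div n = b div n"
    by (metis div_mult_mod_eq)
  have eq': "a = b + n \<longleftrightarrow> a mod n = b mod n \<and> a div n = Suc (b div n)"
    using n_pos by (metis add.commute div_add_self2 div_mult_mod_eq mod_add_self2 not_gr_zero plus_1_eq_Suc)
  have x: "shift [:-\<alpha>, 1:] = monom 1 1" by (simp add: pcompose_pCons monom_altdef)
  have shift_D: "shift (linear_diag k $$ (a mod n, b mod n))
      = (if a mod n = b mod n then if b mod n = k then monom 1 1 else monom 1 0 else 0)"
    using mod x by (simp add: linear_diag_index pcompose_1 del: pcompose_pCons)
  show ?thesis
    unfolding T_index[OF linear_diag_carrier a b] shift_D by (auto simp: eq eq' split: if_splits)
qed

text \<open>Only coordinate \<open>k\<close> of the last block has no next block to be moved to, so its unit vector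
  spans the kernel.\<close>
lemma kernel_dim_T_linear_diag:
  assumes k: "k < n"
  shows "kernel_dim (T (linear_diag k)) \<le> 1"
proof (rule kernel_dim_le_1[OF T_carrier])
  let ?e = "r * n + k"
  have e: "?e < M" "?e div n = r" "?e mod n = k" using k by auto
  have row: "(T (linear_diag k) *\<^sub>v y) $ a = (if a mod n = k
     then if a < n then 0 else weight (a div n - 1) (a div n) * y $ (a - n) else y $ a)"
    if a: "a < M" and y: "y \<in> carrier_vec M" for a y
  proof -
    have "(T (linear_diag k) *\<^sub>v y) $ a = (\<Sum>b<M. T (linear_diag k) $$ (a, b) * y $ b)"
      using a y by (simp add: scalar_prod_def T_gamma_def lessThan_atLeast0)
    also have "\<dots> = (\<Sum>b<M. if b = (if a mod n = k then a - n else a)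
       then if a mod n = k then if a < n then 0 else weight (a div n - 1) (a div n) * y $ b else y $ b else 0)"
      using a n_pos by (intro sum.cong refl) (auto simp: T_linear_diag_index div_add_self2)
    also have "\<dots> = (if a mod n = k
     then if a < n then 0 else weight (a div n - 1) (a div n) * y $ (a - n) else y $ a)"
      using a by (subst sum.delta) auto
    finally show ?thesis .
  qed
  show "unit_vec M ?e \<in> mat_kernel (T (linear_diag k))"
  proof (rule mat_kernelI[OF T_carrier unit_vec_carrier], rule eq_vecI)
    fix a assume "a < dim_vec (0\<^sub>v M :: complex vec)"
    hence a: "a < M" by simp
    have "a - n \<noteq> ?e" if "\<not> a < n" using a that by auto
    with a e k show "(T (linear_diag k) *\<^sub>v unit_vec M ?e) $ a = 0\<^sub>v M $ a"
      by (subst row) auto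
  qed (simp add: T_gamma_def)
  fix y assume "y \<in> mat_kernel (T (linear_diag k))"
  hence y: "y \<in> carrier_vec M" "T (linear_diag k) *\<^sub>v y = 0\<^sub>v M" by (auto simp: mat_kernel[OF T_carrier])
  have "y $ a = 0" if a: "a < M" "a \<noteq> ?e" for a
  proof (cases "a mod n = k")
    case False
    thus ?thesis using row[OF a(1) y(1)] y(2) a by simp
  next
    case True
    have "a div n \<noteq> r" using True a(2) by (metis div_mult_mod_eq)
    hence "a div n < r" using block_bounds(1)[OF a(1)] by simp
    hence "Suc (a div n) * n \<le> r * n" by (intro mult_le_mono1) simp
    moreover have "a = a div n * n + k" using True by (metis div_mult_mod_eq)
    ultimately have "a + n < M" using k by simp
    from row[OF this y(1)] y(2) this True n_pos
    have "weight (a div n) (Suc (a div n)) * y $ a = 0" by (simp add: div_add_self2)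
    moreover have "weight (a div n) (Suc (a div n)) \<noteq> 0"
      by (rule weight_neq_0) (use \<open>a div n < r\<close> in simp)
    ultimately show ?thesis by simp
  qed
  hence "y = y $ ?e \<cdot>\<^sub>v unit_vec M ?e"
    using y(1) by (intro eq_vecI) (auto simp: unit_vec_def)
  thus "\<exists>c. y = c \<cdot>\<^sub>v unit_vec M ?e" ..
qed

text \<open>If \<open>P(\<alpha>) u = 0\<close> with \<open>u\<^sub>k = 1\<close>, let \<open>V\<close> be the identity matrix with column \<open>k\<close> replaced by \<open>u\<close>.
  Column \<open>k\<close> of \<open>P * V\<close> is \<open>P * u\<close>, which vanishes at \<open>\<alpha>\<close>, so that \<open>x - \<alpha>\<close> can be divided out of it:
  \<open>P * V = R * linear_diag k\<close>. By Cramer's rule \<open>det V = u\<^sub>k = 1\<close>, whence the adjugate of \<open>V\<close> is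
  its inverse.\<close>
lemma split_linear_factor:
  assumes P: "P \<in> carrier_mat n n" and root: "poly (det P) \<alpha> = 0"
  obtains R S k where "R \<in> carrier_mat n n" "S \<in> carrier_mat n n" "k < n"
    "det S = 1" "P = R * (linear_diag k * S)"
proof -
  have "mp_eval P \<alpha> \<in> carrier_mat n n" using P by (simp add: mp_eval_def)
  from det_0_iff_vec_prod_zero_field[OF this] root det_mp_eval[OF P, of \<alpha>]
  obtain v where v: "v \<in> carrier_vec n" "v \<noteq> 0\<^sub>v n" "mp_eval P \<alpha> *\<^sub>v v = 0\<^sub>v n" by auto
  from v(1,2) obtain k where k: "k < n" "v $ k \<noteq> 0"
    by (metis carrier_vecD eq_vecI index_zero_vec(1) index_zero_vec(2))
  \<comment> \<open>Constant polynomials, scaled to make the entry at \<open>k\<close> equal to one.\<close>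
  define u :: "complex poly vec" where "u = vec n (\<lambda>i. [:v $ i / v $ k:])"
  have u: "u \<in> carrier_vec n" "u $ k = 1" using k by (simp_all add: u_def one_pCons)
  define V where "V = replace_col (1\<^sub>m n) u k"
  have V: "V \<in> carrier_mat n n" by (simp add: V_def replace_col_def)
  have "det V = 1"
    using cramer_lemma_mat[of "1\<^sub>m n" n u k] u k by (simp add: V_def)
  note adj = adj_mat[OF V, unfolded this]
  have VS: "V * adj_mat V = 1\<^sub>m n" unfolding adj(2) by (rule eq_matI) auto
  have S: "det (adj_mat V) = 1"
    using det_mult[OF V adj(1)] by (simp add: \<open>det V = 1\<close> VS)
  define R where "R = replace_col P (vec n (\<lambda>i. (P *\<^sub>v u) $ i div [:-\<alpha>, 1:])) k"
  have R: "R \<in> carrier_mat n n" using P by (simp add: R_def replace_col_def)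
  have dvd: "[:-\<alpha>, 1:] dvd (P *\<^sub>v u) $ i" if i: "i < n" for i
  proof -
    have "poly ((P *\<^sub>v u) $ i) \<alpha> = (\<Sum>j<n. poly (P $$ (i, j)) \<alpha> * v $ j) / v $ k"
      using P i by (simp add: scalar_prod_def u_def poly_sum sum_divide_distrib lessThan_atLeast0 mult.commute)
    also have "(\<Sum>j<n. poly (P $$ (i, j)) \<alpha> * v $ j) = (mp_eval P \<alpha> *\<^sub>v v) $ i"
      using P i v(1) by (simp add: scalar_prod_def mp_eval_def lessThan_atLeast0)
    also have "\<dots> = 0" unfolding v(3) using i by simp
    finally show ?thesis by (simp add: poly_eq_0_iff_dvd)
  qed
  have "P * V = R * linear_diag k"
  proof (rule eq_matI)
    fix i j assume "i < dim_row (R * linear_diag k)" "j < dim_col (R * linear_diag k)"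
    hence ij: "i < n" "j < n" using R carrier_matD[OF linear_diag_carrier] by auto
    have RD: "(R * linear_diag k) $$ (i, j) = R $$ (i, j) * (if j = k then [:-\<alpha>, 1:] else 1)"
      unfolding linear_diag_def mat_diag_mult_right[OF R] using ij by simp
    have "col V j = (if j = k then u else unit_vec n j)"
      using ij u by (auto simp: V_def replace_col_def unit_vec_def intro!: eq_vecI)
    hence "(P * V) $$ (i, j) = (if j = k then (P *\<^sub>v u) $ i else P $$ (i, j))"
      using P V ij by auto
    also have "\<dots> = R $$ (i, j) * (if j = k then [:-\<alpha>, 1:] else 1)"
      using P ij dvd_div_mult_self[OF dvd[OF ij(1)]]
      by (simp add: R_def replace_col_def del: mult_pCons_right index_mult_mat_vec)
    finally show "(P * V) $$ (i, j) = (R * linear_diag k) $$ (i, j)" unfolding RD .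
  qed (use P V R carrier_matD[OF linear_diag_carrier] in auto)
  hence "P * V * adj_mat V = R * (linear_diag k * adj_mat V)"
    using assoc_mult_mat[OF R linear_diag_carrier adj(1)] by simp
  moreover have "P * V * adj_mat V = P"
    using P assoc_mult_mat[OF P V adj(1)] VS by simp
  ultimately show ?thesis using that[OF R adj(1) k(1) S] by simp
qed

section \<open>Comparing nullity and multiplicity\<close>

text \<open>Each linear factor that is split off lowers the order of the determinant by exactly one, and
  the nullity by at most one.\<close>
lemma kernel_dim_T_le_order:
  assumes "P \<in> carrier_mat n n" and "det P \<noteq> 0"
  shows "kernel_dim (T P) \<le> order \<alpha> (det P)"
  using assms
proof (induction "order \<alpha> (det P)" arbitrary: P)
  case 0
  hence "poly (det P) \<alpha> \<noteq> 0" by (simp add: order_root)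
  thus ?case using kernel_dim_T_nonsingular[OF 0(2)] by simp
next
  case (Suc m)
  hence "poly (det P) \<alpha> = 0" by (metis order_root Zero_not_Suc)
  then obtain R S k where RS: "R \<in> carrier_mat n n" "S \<in> carrier_mat n n" "k < n" "det S = 1"
    and P: "P = R * (linear_diag k * S)" using split_linear_factor[OF Suc(3)] by metis
  have det: "det P = det R * [:-\<alpha>, 1:]"
    using RS by (simp add: P det_mult[of _ n] det_linear_diag mult_carrier_mat[of _ n n])
  have "order \<alpha> (det P) = order \<alpha> (det R) + order \<alpha> [:-\<alpha>, 1:]"
    using Suc(4) unfolding det by (rule order_mult)
  hence ord: "m = order \<alpha> (det R)" using Suc(2) order_power_n_n[of \<alpha> 1] by simp
  have nz: "det R \<noteq> 0" using Suc(4) det by auto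
  have "T P = T R * (T (linear_diag k) * T S)"
    using RS by (simp add: P T_mult mult_carrier_mat[of _ n n])
  hence "kernel_dim (T P) \<le> kernel_dim (T R) + kernel_dim (T (linear_diag k) * T S)"
    using kernel_dim_mult_le[OF T_carrier[of R] mult_carrier_mat[OF T_carrier[of "linear_diag k"] T_carrier[of S]]] by simp
  moreover have "kernel_dim (T (linear_diag k) * T S) \<le> kernel_dim (T (linear_diag k)) + kernel_dim (T S)"
    by (rule kernel_dim_mult_le[OF T_carrier T_carrier])
  moreover have "kernel_dim (T S) = 0"
    by (rule kernel_dim_T_nonsingular) (simp_all add: RS)
  ultimately show ?case
    using kernel_dim_T_linear_diag[OF RS(3)] Suc(1)[OF ord RS(1) nz] Suc(2) ord by linarith
qed

text \<open>The converse estimate needs a right factor whose determinant vanishes to an exactly prescribed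
  order. Splitting linear factors off the left cofactor \<open>R\<close> repeatedly builds it up one order at a
  time.\<close>
lemma split_order:
  assumes P: "P \<in> carrier_mat n n" and nz: "det P \<noteq> 0" and "N \<le> order \<alpha> (det P)"
  shows "\<exists>R L. R \<in> carrier_mat n n \<and> L \<in> carrier_mat n n \<and> P = R * L \<and> det L = [:-\<alpha>, 1:] ^ N"
  using assms(3)
proof (induction N)
  case 0
  thus ?case using P by (intro exI[of _ P] exI[of _ "1\<^sub>m n"]) simp
next
  case (Suc N)
  then obtain R L where RL: "R \<in> carrier_mat n n" "L \<in> carrier_mat n n" "P = R * L"
    "det L = [:-\<alpha>, 1:] ^ N" by auto
  have det: "det P = det R * [:-\<alpha>, 1:] ^ N" using RL by (simp add: det_mult)
  hence "order \<alpha> (det P) = order \<alpha> (det R) + N"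
    using nz by (metis order_mult order_power_n_n)
  hence "poly (det R) \<alpha> = 0" using Suc(2) by (metis order_root add_cancel_right_left not_less_eq_eq order_refl)
  then obtain R' S k where R': "R' \<in> carrier_mat n n" "S \<in> carrier_mat n n" "k < n" "det S = 1"
    and R: "R = R' * (linear_diag k * S)" using split_linear_factor[OF RL(1)] by metis
  let ?K = "linear_diag k * S"
  have K: "?K \<in> carrier_mat n n" using R' by (simp add: mult_carrier_mat[of _ n n])
  have "P = R' * (?K * L)" using RL R assoc_mult_mat[OF R'(1) K RL(2)] by simp
  moreover have "det (?K * L) = [:-\<alpha>, 1:] ^ Suc N"
    using R' RL by (simp add: det_mult[OF K] det_mult[OF linear_diag_carrier] det_linear_diag)
  ultimately show ?case using R'(1) K RL(2) by (metis mult_carrier_mat)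
qed

lemma T_scalar_zero:
  assumes "[:-\<alpha>, 1:] ^ (r + 1) dvd p"
  shows "T (p \<cdot>\<^sub>m 1\<^sub>m n) = 0\<^sub>m M M" (is "T ?D = _")
proof (rule eq_matI)
  fix a b assume "a < dim_row (0\<^sub>m M M :: complex mat)" "b < dim_col (0\<^sub>m M M :: complex mat)"
  hence ab: "a < M" "b < M" by simp_all
  have D: "?D \<in> carrier_mat n n" by simp
  from assms obtain q where p: "p = [:-\<alpha>, 1:] ^ (r + 1) * q" by (elim dvdE)
  have "a div n - b div n < r + 1" using block_bounds[OF ab(1)] by simp
  hence "coeff (shift p) (a div n - b div n) = 0"
    unfolding p coeff_shift_mult_power by simp
  moreover have "?D $$ (a mod n, b mod n) = (if a mod n = b mod n then p else 0)"
    using n_pos by simp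
  ultimately show "T ?D $$ (a, b) = 0\<^sub>m M M $$ (a, b)"
    using ab by (simp add: T_index[OF D ab])
qed (simp_all add: T_gamma_def)

text \<open>Let \<open>L\<close> be a right factor of \<open>P\<close> with determinant \<open>(x - \<alpha>) ^ (r + 1)\<close>. Then \<open>L * adj_mat L\<close> is zero
  modulo that power, so the nullities of \<open>T L\<close> and \<open>T (adj_mat L)\<close> add up to at least
  \<open>(r + 1) * n\<close>. The determinant of the adjugate has order \<open>(r + 1) * (n - 1)\<close>, and the upper bound
  on its nullity leaves at least \<open>r + 1\<close> for \<open>L\<close>. The exact order of \<open>det L\<close> is essential: for \<open>P\<close>
  itself, with a larger order, the bound for the adjugate would be too weak.\<close>
lemma kernel_dim_T_ge:
  assumes P: "P \<in> carrier_mat n n" and nz: "det P \<noteq> 0" and ord: "r + 1 \<le> order \<alpha> (det P)"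
  shows "r + 1 \<le> kernel_dim (T P)"
proof -
  let ?x = "[:-\<alpha>, 1:]"
  from split_order[OF P nz ord] obtain R L where
    RL: "R \<in> carrier_mat n n" "L \<in> carrier_mat n n" "P = R * L" "det L = ?x ^ (r + 1)" by blast
  note adj = adj_mat[OF RL(2)]
  have "det L * det (adj_mat L) = det L ^ n"
    using adj(2) det_mult[OF RL(2) adj(1)] by simp
  also have "\<dots> = det L * det L ^ (n - 1)" using n_pos by (cases n) simp_all
  finally have "det (adj_mat L) = det L ^ (n - 1)"
    using RL(4) by (metis mult_left_cancel pCons_eq_0_iff power_not_zero zero_neq_one)
  hence det_adj: "det (adj_mat L) = ?x ^ ((r + 1) * (n - 1))"
    by (simp only: RL(4) power_mult)
  hence "kernel_dim (T (adj_mat L)) \<le> (r + 1) * (n - 1)"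
    using kernel_dim_T_le_order[OF adj(1)] order_power_n_n[of \<alpha> "(r + 1) * (n - 1)"] by simp
  moreover have "T L * T (adj_mat L) = 0\<^sub>m M M"
    using T_scalar_zero[of "det L"] by (simp only: adj(2) RL(4) dvd_refl flip: T_mult[OF RL(2) adj(1)])
  hence "M \<le> kernel_dim (T L) + kernel_dim (T (adj_mat L))"
    using kernel_dim_mult_le[OF T_carrier[of L] T_carrier[of "adj_mat L"]] by simp
  moreover have "kernel_dim (T L) \<le> kernel_dim (T P)"
    using kernel_dim_right_le[OF T_carrier[of R] T_carrier[of L]] RL by (simp add: T_mult)
  moreover have "M = (r + 1) * (n - 1) + (r + 1)" using n_pos by (cases n) simp_all
  ultimately show ?thesis by linarith
qed

theorem rank_T_le_iff:
  assumes P: "P \<in> carrier_mat n n" and nz: "det P \<noteq> 0"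
  shows "vec_space.rank M (T P) \<le> (r + 1) * (n - 1) \<longleftrightarrow> r + 1 \<le> order \<alpha> (det P)"
proof -
  have "M = (r + 1) * (n - 1) + (r + 1)" using n_pos by (cases n) simp_all
  hence "vec_space.rank M (T P) \<le> (r + 1) * (n - 1) \<longleftrightarrow> r + 1 \<le> kernel_dim (T P)"
    using rank_plus_kernel_dim[OF T_carrier[of P]] by linarith
  also have "\<dots> \<longleftrightarrow> r + 1 \<le> order \<alpha> (det P)"
    using kernel_dim_T_ge[OF P nz] kernel_dim_T_le_order[OF P nz] by linarith
  finally show ?thesis .
qed

end

theorem theorem4p1:
  fixes n k r :: nat
    and A :: "nat \<Rightarrow> complex mat"
    and \<gamma> :: "nat \<Rightarrow> real"
    and z\<^sub>0 :: complex
  assumes "n \<ge> 1"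
    and "\<And>i. i \<le> k \<Longrightarrow> A i \<in> carrier_mat n n"
    and "mp_regular (matrix_poly n k A)"
    and "r \<ge> 1"
    and "\<And>i. 1 \<le> i \<Longrightarrow> i \<le> r \<Longrightarrow> \<gamma> i > 0"
  shows "(mp_eigenvalue (matrix_poly n k A) z\<^sub>0 \<and> mp_alg_mult (matrix_poly n k A) z\<^sub>0 \<ge> r + 1)
    \<longleftrightarrow> vec_space.rank ((r + 1) * n) (T_gamma n r \<gamma> (matrix_poly n k A) z\<^sub>0) \<le> (r + 1) * (n - 1)"
proof -
  let ?P = "matrix_poly n k A"
  interpret block_toeplitz n r \<gamma> z\<^sub>0
    using assms(1) assms(5) by unfold_locales (auto simp: less_le)
  have P: "?P \<in> carrier_mat n n" by (simp add: matrix_poly_def)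
  have nz: "det ?P \<noteq> 0" using assms(3) by (simp add: mp_regular_def)
  have "mp_eigenvalue ?P z\<^sub>0 \<and> mp_alg_mult ?P z\<^sub>0 \<ge> r + 1 \<longleftrightarrow> r + 1 \<le> order z\<^sub>0 (det ?P)"
    using nz by (auto simp: mp_eigenvalue_def mp_alg_mult_def order_root)
  with rank_T_le_iff[OF P nz] show ?thesis by simp
qed

end
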